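(* Let $\mathcal M$ be the real vector space of all tensors $M^{ijkl}=C^{i(jk)l}$, where $C$ ranges over all elasticity tensors in three dimensions. Then $\dim\mathcal M=21$.
   Context: Indices run over $1,2,3$. An elasticity tensor is a real fourth-rank tensor $C^{ijkl}$ on $\mathbb R^3$ with $C^{ijkl}=C^{jikl}$, $C^{ijkl}=C^{ijlk}$ (minor symmetries) and $C^{ijkl}=C^{klij}$ (major symmetry). Here $C^{i(jk)l}=\frac12(C^{ijkl}+C^{ikjl})$. *)

theory Defs
  imports "HOL-Analysis.Analysis"
begin

text \<open>
  The component with indices \<open>i, j, k, l\<close>, in this order, of a fourth-rank tensor \<open>C\<close>
  is \<open>C $ i $ j $ k $ l\<close>.
\<close>

type_synonym tensor4 = "real ^ 3 ^ 3 ^ 3 ^ 3"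

definition elasticity_tensor :: "tensor4 \<Rightarrow> bool" where
  "elasticity_tensor C \<longleftrightarrow>
     (\<forall>i j k l. C $ i $ j $ k $ l = C $ j $ i $ k $ l) \<and>
     (\<forall>i j k l. C $ i $ j $ k $ l = C $ i $ j $ l $ k) \<and>
     (\<forall>i j k l. C $ i $ j $ k $ l = C $ k $ l $ i $ j)"

definition sym_middle :: "tensor4 \<Rightarrow> tensor4" where
  "sym_middle C = (\<chi> i j k l. 1/2 * (C $ i $ j $ k $ l + C $ i $ k $ j $ l))"

definition M_space :: "tensor4 set" where
  "M_space = {sym_middle C | C. elasticity_tensor C}"

end

theory Submission
  imports Defs
begin

text \<open>
  Write \<open>M\<close> for \<open>sym_middle C\<close>. The three pairings \<open>ij|kl\<close>, \<open>ik|jl\<close>, \<open>il|jk\<close> of the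
  indices give three components of \<open>C\<close>, and the components of \<open>M\<close> are their pairwise means.
  Hence \<open>C\<^sup>i\<^sup>j\<^sup>k\<^sup>l = M\<^sup>i\<^sup>j\<^sup>k\<^sup>l + M\<^sup>i\<^sup>j\<^sup>l\<^sup>k - M\<^sup>i\<^sup>k\<^sup>l\<^sup>j\<close>, so the middle symmetrization is
  injective on elasticity tensors. An elasticity tensor is an arbitrary function of the
  unordered pair of unordered pairs \<open>{{i,j},{k,l}}\<close>; there are 6 unordered pairs
  (with repetition) of indices and 21 unordered pairs of those.
\<close>

definition upairs :: "'a set \<Rightarrow> 'a set set" where
  "upairs A = {{x, y} | x y. x \<in> A \<and> y \<in> A}"

text \<open>The cases \<open>x = y\<close> and \<open>x \<noteq> y\<close> give sets of size 1 and
  2, which binomial coefficients count.\<close>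

lemma upairs_eq: "upairs A = {B. B \<subseteq> A \<and> card B = 1} \<union> {B. B \<subseteq> A \<and> card B = 2}"
proof (intro set_eqI iffI)
  fix B assume "B \<in> upairs A"
  then obtain x y where "B = {x, y}" "x \<in> A" "y \<in> A"
    by (auto simp: upairs_def)
  then show "B \<in> {B. B \<subseteq> A \<and> card B = 1} \<union> {B. B \<subseteq> A \<and> card B = 2}"
    by (cases "x = y") auto
next
  fix B assume "B \<in> {B. B \<subseteq> A \<and> card B = 1} \<union> {B. B \<subseteq> A \<and> card B = 2}"
  then show "B \<in> upairs A"
    by (auto simp: upairs_def card_1_singleton_iff card_2_iff)
qed

lemma finite_upairs: "finite A \<Longrightarrow> finite (upairs A)"
  by (simp add: upairs_eq)

lemma card_upairs:
  assumes "finite A"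
  shows "card (upairs A) = card A + (card A choose 2)"
proof -
  have "card (upairs A) = card {B. B \<subseteq> A \<and> card B = 1} + card {B. B \<subseteq> A \<and> card B = 2}"
    unfolding upairs_eq by (rule card_Un_disjoint) (use assms in auto)
  then show ?thesis
    by (simp only: n_subsets[OF assms]) simp
qed

text \<open>Nested unordered pairs absorb the two minor symmetries (inner sets) and the major one
  (outer set), so two index quadruples have the same value exactly when these symmetries connect
  them.\<close>

abbreviation orbit :: "3 \<Rightarrow> 3 \<Rightarrow> 3 \<Rightarrow> 3 \<Rightarrow> 3 set set" where
  "orbit i j k l \<equiv> {{i, j}, {k, l}}"

definition orbits :: "3 set set set" where
  "orbits = upairs (upairs UNIV)"

lemma orbits_eq: "orbits = {orbit i j k l | i j k l. True}"
  by (auto simp: orbits_def upairs_def)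

lemma finite_orbits: "finite orbits"
  by (simp add: orbits_def finite_upairs)

text \<open>Counting twice: 3 + 3 = 6 inner pairs, then 6 + 15 = 21 outer ones.\<close>

lemma card_orbits: "card orbits = 21"
  by (simp add: orbits_def card_upairs finite_upairs choose_two)

text \<open>For \<open>S\<close> in \<open>orbits\<close> these indicator tensors will form the
  basis of the elasticity tensors.\<close>

definition orbit_tensor :: "3 set set \<Rightarrow> tensor4" where
  "orbit_tensor S = (\<chi> i j k l. if orbit i j k l = S then 1 else 0)"

lemma orbit_tensor_nth: "orbit_tensor S $ i $ j $ k $ l = (if orbit i j k l = S then 1 else 0)"
  by (simp add: orbit_tensor_def)

lemma elasticity_orbit_tensor: "elasticity_tensor (orbit_tensor S)"
  by (simp add: elasticity_tensor_def orbit_tensor_nth insert_commute)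

lemma elasticity_tensor_orbit_cong:
  assumes "elasticity_tensor C" and "orbit i j k l = orbit i' j' k' l'"
  shows "C $ i $ j $ k $ l = C $ i' $ j' $ k' $ l'"
  using assms unfolding elasticity_tensor_def doubleton_eq_iff by metis

lemma orbit_tensor_nonzero:
  assumes "S \<in> orbits"
  shows "orbit_tensor S \<noteq> 0"
proof -
  obtain i j k l where "S = orbit i j k l"
    using assms by (auto simp: orbits_eq)
  then have "orbit_tensor S $ i $ j $ k $ l \<noteq> 0"
    by (simp add: orbit_tensor_nth)
  then show ?thesis
    by (metis zero_index)
qed

text \<open>The supports are disjoint, since a quadruple has only one orbit.\<close>

lemma orthogonal_orbit_tensors:
  assumes "S \<noteq> T"
  shows "orthogonal (orbit_tensor S) (orbit_tensor T)"
proof -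
  have "orbit_tensor S $ i $ j $ k $ l * orbit_tensor T $ i $ j $ k $ l = 0" for i j k l
    using assms by (simp add: orbit_tensor_nth)
  then show ?thesis
    by (simp only: orthogonal_def inner_vec_def inner_real_def sum.neutral_const)
qed

text \<open>A collision would make a nonzero tensor orthogonal to itself.\<close>

lemma inj_on_orbit_tensor: "inj_on orbit_tensor orbits"
proof (rule inj_onI, rule ccontr)
  fix S T
  assume "S \<in> orbits" and eq: "orbit_tensor S = orbit_tensor T" and "S \<noteq> T"
  then have "orthogonal (orbit_tensor S) (orbit_tensor S)"
    using orthogonal_orbit_tensors[of S T] by simp
  with orbit_tensor_nonzero[OF \<open>S \<in> orbits\<close>] show False
    by (simp add: orthogonal_self)
qed

lemma independent_orbit_tensors: "independent (orbit_tensor ` orbits)"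
proof (rule pairwise_orthogonal_independent)
  show "pairwise orthogonal (orbit_tensor ` orbits)"
    by (auto simp: pairwise_def intro: orthogonal_orbit_tensors)
  show "0 \<notin> orbit_tensor ` orbits"
    using orbit_tensor_nonzero by force
qed

lemma subspace_elasticity: "subspace {C. elasticity_tensor C}"
proof (rule subspaceI)
  fix C D assume "C \<in> {C. elasticity_tensor C}" "D \<in> {C. elasticity_tensor C}"
  then show "C + D \<in> {C. elasticity_tensor C}"
    unfolding elasticity_tensor_def mem_Collect_eq vector_add_component by metis
next
  fix C and r :: real assume "C \<in> {C. elasticity_tensor C}"
  then show "r *\<^sub>R C \<in> {C. elasticity_tensor C}"
    unfolding elasticity_tensor_def mem_Collect_eq vector_scaleR_component by metis
qed (simp add: elasticity_tensor_def)

lemma span_orbit_tensors: "span (orbit_tensor ` orbits) = {C. elasticity_tensor C}"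
proof
  show "span (orbit_tensor ` orbits) \<subseteq> {C. elasticity_tensor C}"
    by (rule span_minimal) (auto simp: elasticity_orbit_tensor subspace_elasticity)
  show "{C. elasticity_tensor C} \<subseteq> span (orbit_tensor ` orbits)"
  proof clarify
    fix C assume C: "elasticity_tensor C"
    \<comment> \<open>The coefficient is the common value of \<open>C\<close> on the orbit;
      \<open>elasticity_tensor_orbit_cong\<close> makes it independent of the chosen
      representative.\<close>
    define c where "c S = (SOME r. \<exists>i j k l. S = orbit i j k l \<and> r = C $ i $ j $ k $ l)" for S
    have c: "c (orbit i j k l) = C $ i $ j $ k $ l" for i j k l
      unfolding c_def
    proof (rule some_equality)
      fix r assume "\<exists>i' j' k' l'. orbit i j k l = orbit i' j' k' l' \<and> r = C $ i' $ j' $ k' $ l'"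
      then obtain i' j' k' l'
        where "orbit i j k l = orbit i' j' k' l'" and r: "r = C $ i' $ j' $ k' $ l'"
        by iprover
      from elasticity_tensor_orbit_cong[OF C this(1)] r show "r = C $ i $ j $ k $ l"
        by simp
    qed (rule exI conjI refl)+
    have "(\<Sum>S\<in>orbits. c S *\<^sub>R orbit_tensor S) $ i $ j $ k $ l = C $ i $ j $ k $ l" for i j k l
    proof -
      have "orbit i j k l \<in> orbits"
        by (auto simp: orbits_eq)
      \<comment> \<open>At a fixed quadruple only the summand of its own orbit survives.\<close>
      moreover have "(\<Sum>S\<in>orbits. c S *\<^sub>R orbit_tensor S) $ i $ j $ k $ l
          = (\<Sum>S\<in>orbits. if orbit i j k l = S then c S else 0)"
        unfolding sum_component by (rule sum.cong) (auto simp: orbit_tensor_nth)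
      ultimately show ?thesis
        by (simp only: sum.delta'[OF finite_orbits] if_True c)
    qed
    then have "C = (\<Sum>S\<in>orbits. c S *\<^sub>R orbit_tensor S)"
      by (simp add: vec_eq_iff)
    also have "\<dots> \<in> span (orbit_tensor ` orbits)"
      by (intro span_sum span_scale span_base imageI)
    finally show "C \<in> span (orbit_tensor ` orbits)" .
  qed
qed

lemma dim_elasticity: "dim {C. elasticity_tensor C} = 21"
proof -
  have "dim {C. elasticity_tensor C} = card (orbit_tensor ` orbits)"
    unfolding span_orbit_tensors[symmetric] dim_span
    by (rule dim_eq_card_independent[OF independent_orbit_tensors])
  then show ?thesis
    by (simp add: card_image inj_on_orbit_tensor card_orbits)
qed

lemma linear_sym_middle: "linear sym_middle"
  by (rule linearI) (simp_all add: sym_middle_def vec_eq_iff algebra_simps)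

text \<open>With a, b, d the components of \<open>C\<close> for the pairings ij|kl, ik|jl, il|jk,
  the right-hand side is (a+b)/2 + (a+d)/2 - (b+d)/2 = a.\<close>

lemma sym_middle_inverse:
  assumes "elasticity_tensor C"
  shows "C $ i $ j $ k $ l =
    sym_middle C $ i $ j $ k $ l + sym_middle C $ i $ j $ l $ k - sym_middle C $ i $ k $ l $ j"
proof -
  have "C $ i $ j $ l $ k = C $ i $ j $ k $ l" "C $ i $ k $ l $ j = C $ i $ k $ j $ l"
    "C $ i $ l $ k $ j = C $ i $ l $ j $ k"
    using assms by (simp_all add: elasticity_tensor_def)
  then show ?thesis
    by (simp add: sym_middle_def field_simps)
qed

lemma inj_on_sym_middle: "inj_on sym_middle {C. elasticity_tensor C}"
proof (rule inj_onI)
  fix C D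
  assume "C \<in> {C. elasticity_tensor C}" "D \<in> {C. elasticity_tensor C}"
    and "sym_middle C = sym_middle D"
  then have "C $ i $ j $ k $ l = D $ i $ j $ k $ l" for i j k l
    using sym_middle_inverse[of C i j k l] sym_middle_inverse[of D i j k l] by simp
  then show "C = D"
    by (simp add: vec_eq_iff)
qed

theorem proposition5:
  shows "subspace M_space \<and> dim M_space = 21"
proof -
  have M: "M_space = sym_middle ` {C. elasticity_tensor C}"
    by (auto simp: M_space_def)
  have "dim M_space = dim {C. elasticity_tensor C}"
    unfolding M using linear_sym_middle inj_on_sym_middle
    \<comment> \<open>\<open>dim_image_eq\<close> asks for injectivity on the span, which is the
      subspace itself.\<close>
    by (intro dim_image_eq) (simp_all add: span_eq_iff[THEN iffD2, OF subspace_elasticity])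
  then show ?thesis
    by (simp add: M dim_elasticity linear_subspace_image[OF linear_sym_middle subspace_elasticity])
qed

end
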